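(* Let $d$ be a nonnegative integer. The following are equivalent: (i) for every generalized ellipsoid $\mathcal{E}_d\subset\mathbb{R}^n$ of degree $d$ centered at the origin (in any dimension $n$), there exist a nonnegative integer $m$ and positive semidefinite matrices $P_1,\dots,P_m$ such that $$\mathcal{E}_d=\{x\in\mathbb{R}^n \mid x^TP_ix\le 1,\quad i=1,\dots,m\};$$ (ii) $d\in\{0,1\}$.
   Context: A set $\mathcal{E}_d\subset\mathbb{R}^n$ is a generalized ellipsoid of degree $d$ (GE-$d$) centered at the origin if it can be written as $\mathcal{E}_d=\{x\in\mathbb{R}^n\mid x^TP(t)x\le 1\ \ \forall t\in[-1,1]\}$ for some univariate polynomial matrix $P(t)$ (a real symmetric $n\times n$ matrix whose entries are polynomials in $t$) of degree at most $d$ that satisfies $P(t)\succeq 0$ for all $t\in[-1,1]$ and $\bigcap_{t\in[-1,1]}\mathrm{Ker}(P(t))=\{0\}$. *)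

theory Defs
  imports
    "Jordan_Normal_Form.Matrix_Kernel"
    "HOL-Computational_Algebra.Polynomial"
    Complex_Main
begin

text \<open>
  The dimension is quantified inside the theorem, so vectors and matrices are those
  of Jordan Normal Form, with \<open>carrier_vec n\<close> playing the role of the space of real \<open>n\<close>-vectors.
\<close>

definition psd_mat :: "nat \<Rightarrow> real mat \<Rightarrow> bool" where
  "psd_mat n A \<longleftrightarrow>
     A \<in> carrier_mat n n \<and> transpose_mat A = A \<and>
     (\<forall>x\<in>carrier_vec n. 0 \<le> x \<bullet> (A *\<^sub>v x))"

definition eval_poly_mat :: "real poly mat \<Rightarrow> real \<Rightarrow> real mat" where
  "eval_poly_mat P t = map_mat (\<lambda>p. poly p t) P"

definition sym_poly_mat :: "nat \<Rightarrow> nat \<Rightarrow> real poly mat \<Rightarrow> bool" where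
  "sym_poly_mat n d P \<longleftrightarrow>
     P \<in> carrier_mat n n \<and> transpose_mat P = P \<and>
     (\<forall>i<n. \<forall>j<n. degree (P $$ (i, j)) \<le> d)"

definition generalized_ellipsoid :: "nat \<Rightarrow> nat \<Rightarrow> real vec set \<Rightarrow> bool" where
  "generalized_ellipsoid n d E \<longleftrightarrow>
     (\<exists>P. sym_poly_mat n d P \<and>
          (\<forall>t\<in>{-1..1}. psd_mat n (eval_poly_mat P t)) \<and>
          (\<Inter>t\<in>{-1..1}. mat_kernel (eval_poly_mat P t)) = {0\<^sub>v n} \<and>
          E = {x \<in> carrier_vec n. \<forall>t\<in>{-1..1}. x \<bullet> (eval_poly_mat P t *\<^sub>v x) \<le> 1})"

end

theory Submission
  imports Defs
begin

text \<open>
  For degree at most one, \<open>x\<^sup>T P(t) x\<close> is an affine function of \<open>t\<close>, so on \<open>[-1,1]\<close> it is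
  largest at an endpoint and the two matrices \<open>P(-1)\<close> and \<open>P(1)\<close> already cut out the set.

  For every degree bound from two on, one planar example suffices, given by the matrix with
  rows \<open>(2 - t\<^sup>2, t)\<close> and \<open>(t, 1)\<close>. Completing the square,
  \<open>x\<^sup>T P(t) x = 2 (x\<^sub>0\<^sup>2 + x\<^sub>1\<^sup>2) - (t x\<^sub>0 - x\<^sub>1)\<^sup>2\<close>.
  In the cone \<open>\<bar>x\<^sub>1\<bar> \<le> \<bar>x\<^sub>0\<bar>\<close> the square vanishes for some \<open>t\<close> in \<open>[-1,1]\<close>, so there the set
  is bounded by an arc of the circle \<open>x\<^sub>0\<^sup>2 + x\<^sub>1\<^sup>2 = 1/2\<close>; still, the set contains the point
  \<open>(0,1)\<close> outside that circle. If finitely many quadratic inequalities described the set,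
  each of the infinitely many points of the arc would make one of them tight. But a
  quadratic form that is tight at infinitely many points of the arc is \<open>2 (x\<^sub>0\<^sup>2 + x\<^sub>1\<^sup>2)\<close>,
  which exceeds \<open>1\<close> at \<open>(0,1)\<close>. The lemma \<open>finite_family_tight_on_ray\<close> produces the tight
  inequality, and \<open>arc_not_finitely_many_quadratics\<close> counts the tight points as roots of
  polynomials.
\<close>

section \<open>Degree at most one\<close>

lemma poly_affine_interpolation:
  fixes p :: "real poly"
  assumes "degree p \<le> 1"
  shows "poly p t = (1 - t) / 2 * poly p (-1) + (1 + t) / 2 * poly p 1"
proof -
  have "p = [:coeff p 0, coeff p 1:]"
    using assms by (intro poly_eqI) (auto simp: coeff_pCons coeff_eq_0 split: nat.split)
  then obtain a b where "p = [:a, b:]" by blast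
  then show ?thesis by (simp add: field_simps)
qed

lemma smult_mat_mult_vec:
  fixes A :: "'a :: comm_semiring_0 mat"
  assumes "A \<in> carrier_mat m n" "x \<in> carrier_vec n"
  shows "(c \<cdot>\<^sub>m A) *\<^sub>v x = c \<cdot>\<^sub>v (A *\<^sub>v x)"
  using assms by (intro eq_vecI) (auto simp: scalar_prod_def sum_distrib_left mult.assoc)

lemma quad_form_affine_interpolation:
  assumes P: "sym_poly_mat n d P" and d: "d \<le> 1" and x: "x \<in> carrier_vec n"
  shows "x \<bullet> (eval_poly_mat P t *\<^sub>v x) =
    (1 - t) / 2 * (x \<bullet> (eval_poly_mat P (-1) *\<^sub>v x)) + (1 + t) / 2 * (x \<bullet> (eval_poly_mat P 1 *\<^sub>v x))"
proof -
  have PC: "P \<in> carrier_mat n n" using P by (simp add: sym_poly_mat_def)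
  then have C: "eval_poly_mat P u \<in> carrier_mat n n" for u by (simp add: eval_poly_mat_def)
  have "eval_poly_mat P t = ((1 - t) / 2) \<cdot>\<^sub>m eval_poly_mat P (-1) + ((1 + t) / 2) \<cdot>\<^sub>m eval_poly_mat P 1"
  proof (rule eq_matI)
    fix i j
    assume "i < dim_row (((1 - t) / 2) \<cdot>\<^sub>m eval_poly_mat P (-1) + ((1 + t) / 2) \<cdot>\<^sub>m eval_poly_mat P 1)"
      "j < dim_col (((1 - t) / 2) \<cdot>\<^sub>m eval_poly_mat P (-1) + ((1 + t) / 2) \<cdot>\<^sub>m eval_poly_mat P 1)"
    then have ij: "i < n" "j < n" using C[of 1] by auto
    then have "degree (P $$ (i, j)) \<le> 1" using P d by (fastforce simp: sym_poly_mat_def)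
    from poly_affine_interpolation[OF this, of t] ij PC
    show "eval_poly_mat P t $$ (i, j) =
      (((1 - t) / 2) \<cdot>\<^sub>m eval_poly_mat P (-1) + ((1 + t) / 2) \<cdot>\<^sub>m eval_poly_mat P 1) $$ (i, j)"
      by (simp add: eval_poly_mat_def)
  qed (use C[of t] C[of 1] in auto)
  moreover have "(c \<cdot>\<^sub>m A + e \<cdot>\<^sub>m B) *\<^sub>v x = c \<cdot>\<^sub>v (A *\<^sub>v x) + e \<cdot>\<^sub>v (B *\<^sub>v x)"
    if "A \<in> carrier_mat n n" "B \<in> carrier_mat n n" for c e :: real and A B
    using that x by (simp add: add_mult_distrib_mat_vec[of _ n n] smult_mat_mult_vec[of _ n n])
  ultimately show ?thesis
    using C[of "-1"] C[of 1] x by (simp add: scalar_prod_add_distrib[of _ n])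
qed

lemma generalized_ellipsoid_degree_le_1:
  assumes "generalized_ellipsoid n d E" and d: "d \<le> 1"
  obtains A B where "psd_mat n A" "psd_mat n B"
    "E = {x \<in> carrier_vec n. x \<bullet> (A *\<^sub>v x) \<le> 1 \<and> x \<bullet> (B *\<^sub>v x) \<le> 1}"
proof -
  obtain P where P: "sym_poly_mat n d P"
    and psd: "\<forall>t\<in>{-1..1}. psd_mat n (eval_poly_mat P t)"
    and E: "E = {x \<in> carrier_vec n. \<forall>t\<in>{-1..1}. x \<bullet> (eval_poly_mat P t *\<^sub>v x) \<le> 1}"
    using assms(1) unfolding generalized_ellipsoid_def by blast
  have le: "x \<bullet> (eval_poly_mat P t *\<^sub>v x) \<le> 1"
    if x: "x \<in> carrier_vec n" and t: "t \<in> {-1..1}"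
      and le: "x \<bullet> (eval_poly_mat P (-1) *\<^sub>v x) \<le> 1" "x \<bullet> (eval_poly_mat P 1 *\<^sub>v x) \<le> 1" for x t
    using convex_bound_le[OF le, of "(1 - t) / 2" "(1 + t) / 2"] t
    unfolding quad_form_affine_interpolation[OF P d x, of t] by (simp add: field_simps)
  have endpoints: "-1 \<in> {-1..1::real}" "1 \<in> {-1..1::real}" by simp_all
  have "E = {x \<in> carrier_vec n. x \<bullet> (eval_poly_mat P (-1) *\<^sub>v x) \<le> 1 \<and>
      x \<bullet> (eval_poly_mat P 1 *\<^sub>v x) \<le> 1}"
    unfolding E using le endpoints by blast
  with psd endpoints show thesis using that by blast
qed

section \<open>A planar set of degree two bounded by a circular arc\<close>

definition vec2 :: "'a \<Rightarrow> 'a \<Rightarrow> 'a vec" where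
  "vec2 a b = vec 2 (\<lambda>i. if i = 0 then a else b)"

lemma vec2_carrier [simp]: "vec2 a b \<in> carrier_vec 2"
  by (simp add: vec2_def)

lemma carrier_vec_2_eq_vec2:
  assumes "x \<in> carrier_vec 2"
  shows "x = vec2 (x $ 0) (x $ 1)"
  using assms by (intro eq_vecI) (auto simp: vec2_def less_2_cases_iff)

lemma quad_form_vec2:
  fixes A :: "real mat"
  assumes "A \<in> carrier_mat 2 2" "transpose_mat A = A"
  shows "vec2 a b \<bullet> (A *\<^sub>v vec2 a b) =
    A $$ (0, 0) * a\<^sup>2 + 2 * A $$ (0, 1) * a * b + A $$ (1, 1) * b\<^sup>2"
proof -
  have "A $$ (1, 0) = A $$ (0, 1)"
    using assms by (metis carrier_matD index_transpose_mat(1) one_less_numeral_iff pos2 semiring_norm(76))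
  then show ?thesis
    using assms(1)
    by (auto simp: vec2_def scalar_prod_def row_def power2_eq_square algebra_simps numeral_2_eq_2)
qed

definition arc_poly_mat :: "real poly mat" where
  "arc_poly_mat = mat 2 2 (\<lambda>(i, j).
     if i \<noteq> j then [:0, 1:] else if i = 0 then [:2, 0, -1:] else [:1:])"

lemma sym_poly_mat_arc: "d \<ge> 2 \<Longrightarrow> sym_poly_mat 2 d arc_poly_mat"
  unfolding sym_poly_mat_def arc_poly_mat_def
  by (auto intro!: eq_matI simp: less_2_cases_iff)

lemma eval_arc_poly_mat:
  shows "eval_poly_mat arc_poly_mat t \<in> carrier_mat 2 2"
    and "transpose_mat (eval_poly_mat arc_poly_mat t) = eval_poly_mat arc_poly_mat t"
    and "vec2 a b \<bullet> (eval_poly_mat arc_poly_mat t *\<^sub>v vec2 a b) = 2 * (a\<^sup>2 + b\<^sup>2) - (t * a - b)\<^sup>2"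
proof -
  show C: "eval_poly_mat arc_poly_mat t \<in> carrier_mat 2 2"
    by (simp add: eval_poly_mat_def arc_poly_mat_def)
  show T: "transpose_mat (eval_poly_mat arc_poly_mat t) = eval_poly_mat arc_poly_mat t"
    unfolding eval_poly_mat_def arc_poly_mat_def
    by (auto intro!: eq_matI simp: less_2_cases_iff)
  show "vec2 a b \<bullet> (eval_poly_mat arc_poly_mat t *\<^sub>v vec2 a b) = 2 * (a\<^sup>2 + b\<^sup>2) - (t * a - b)\<^sup>2"
    unfolding quad_form_vec2[OF C T]
    by (simp add: eval_poly_mat_def arc_poly_mat_def power2_eq_square algebra_simps)
qed

definition arc_set :: "real vec set" where
  "arc_set = {x \<in> carrier_vec 2. \<forall>t\<in>{-1..1}. x \<bullet> (eval_poly_mat arc_poly_mat t *\<^sub>v x) \<le> 1}"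

lemma vec2_in_arc_set_iff:
  "vec2 a b \<in> arc_set \<longleftrightarrow> (\<forall>t\<in>{-1..1}. 2 * (a\<^sup>2 + b\<^sup>2) - (t * a - b)\<^sup>2 \<le> 1)"
  by (simp add: arc_set_def eval_arc_poly_mat(3))

lemma generalized_ellipsoid_arc_set:
  assumes "d \<ge> 2"
  shows "generalized_ellipsoid 2 d arc_set"
proof -
  have psd: "psd_mat 2 (eval_poly_mat arc_poly_mat t)" if t: "t \<in> {-1..1}" for t
  proof -
    have "0 \<le> 2 * (a\<^sup>2 + b\<^sup>2) - (t * a - b)\<^sup>2" for a b
    proof -
      have "t\<^sup>2 \<le> 1" using t by (auto simp: abs_square_le_1)
      then have "0 \<le> (t * a + b)\<^sup>2 + 2 * (1 - t\<^sup>2) * a\<^sup>2" by simp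
      then show ?thesis by (simp add: power2_eq_square algebra_simps)
    qed
    then have "0 \<le> x \<bullet> (eval_poly_mat arc_poly_mat t *\<^sub>v x)" if "x \<in> carrier_vec 2" for x
      using eval_arc_poly_mat(3) carrier_vec_2_eq_vec2[OF that] by metis
    then show ?thesis by (simp add: psd_mat_def eval_arc_poly_mat)
  qed
  \<comment> \<open>The matrix at \<open>t = 0\<close> is positive definite, so its kernel alone is trivial.\<close>
  have "x = 0\<^sub>v 2" if x: "x \<in> mat_kernel (eval_poly_mat arc_poly_mat 0)" for x
  proof -
    have xc: "x \<in> carrier_vec 2" and 0: "eval_poly_mat arc_poly_mat 0 *\<^sub>v x = 0\<^sub>v 2"
      using mat_kernelD[OF eval_arc_poly_mat(1) x] by auto
    have "x \<bullet> (eval_poly_mat arc_poly_mat 0 *\<^sub>v x) = 0" using xc 0 by simp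
    then have "2 * (x $ 0)\<^sup>2 + (x $ 1)\<^sup>2 = 0"
      using eval_arc_poly_mat(3)[of "x $ 0" "x $ 1" 0] carrier_vec_2_eq_vec2[OF xc] by simp
    then have "x $ 0 = 0" "x $ 1 = 0"
      by (simp_all add: add_nonneg_eq_0_iff)
    then show ?thesis using xc by (intro eq_vecI) (auto simp: less_2_cases_iff)
  qed
  moreover have "0\<^sub>v 2 \<in> mat_kernel (eval_poly_mat arc_poly_mat t)" for t
    using eval_arc_poly_mat(1)[of t] by (intro mat_kernelI[OF eval_arc_poly_mat(1)]) auto
  ultimately have "(\<Inter>t\<in>{-1..1}. mat_kernel (eval_poly_mat arc_poly_mat t)) = {0\<^sub>v 2}"
    by force
  with psd sym_poly_mat_arc[OF assms] show ?thesis
    unfolding generalized_ellipsoid_def arc_set_def by blast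
qed

text \<open>
  The ray through \<open>(1,s)\<close> leaves the set on the circle: the parameter \<open>t = s\<close> removes the
  subtracted square, and every other parameter only weakens the inequality.
\<close>

lemma arc_set_on_ray:
  assumes s: "s \<in> {-1..1}"
  shows "vec2 r (r * s) \<in> arc_set \<longleftrightarrow> r\<^sup>2 * (2 + 2 * s\<^sup>2) \<le> 1"
proof
  assume "vec2 r (r * s) \<in> arc_set"
  then have "2 * (r\<^sup>2 + (r * s)\<^sup>2) - (s * r - r * s)\<^sup>2 \<le> 1"
    using s vec2_in_arc_set_iff by blast
  then show "r\<^sup>2 * (2 + 2 * s\<^sup>2) \<le> 1" by (simp add: power_mult_distrib algebra_simps)
next
  assume "r\<^sup>2 * (2 + 2 * s\<^sup>2) \<le> 1"
  then have "2 * (r\<^sup>2 + (r * s)\<^sup>2) \<le> 1" by (simp add: power_mult_distrib algebra_simps)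
  then have "2 * (r\<^sup>2 + (r * s)\<^sup>2) - (t * r - r * s)\<^sup>2 \<le> 1" for t
    using zero_le_power2[of "t * r - r * s"] by linarith
  then show "vec2 r (r * s) \<in> arc_set" by (simp add: vec2_in_arc_set_iff)
qed

section \<open>Finitely many quadratic inequalities do not suffice\<close>

text \<open>
  Here \<open>q i\<close> is the value of the \<open>i\<close>-th quadratic form at a fixed direction and \<open>g\<close> that of
  the squared gauge of the set: if every \<open>q i\<close> were below \<open>g\<close>, the ray could be followed
  slightly beyond the boundary of the set without violating any of the inequalities.
\<close>

lemma finite_family_tight_on_ray:
  fixes q :: "'i \<Rightarrow> real"
  assumes I: "finite I" and g: "0 < g"
    and ray: "\<And>r. (\<forall>i\<in>I. r\<^sup>2 * q i \<le> 1) \<longleftrightarrow> r\<^sup>2 * g \<le> 1"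
  shows "\<exists>i\<in>I. q i = g"
proof (rule ccontr)
  assume neq: "\<not> (\<exists>i\<in>I. q i = g)"
  have "q i \<le> g" if "i \<in> I" for i
    using ray[of "1 / sqrt g"] g that by (auto simp: field_simps power_divide)
  then have less: "\<forall>i\<in>I. q i < g" using neq by (auto simp: less_le)
  \<comment> \<open>Including \<open>g / 2\<close> keeps \<open>M\<close> positive, also for an empty family.\<close>
  define M where "M = Max (insert (g / 2) (q ` I))"
  have "M < g" using less g I by (simp add: M_def)
  have "0 < M" "\<forall>i\<in>I. q i \<le> M"
    using I g by (auto simp: M_def Max_gr_iff)
  then have "(1 / sqrt M)\<^sup>2 * g \<le> 1"
    using ray[of "1 / sqrt M"] by (auto simp: power_divide field_simps)
  then show False using \<open>0 < M\<close> \<open>M < g\<close> by (simp add: power_divide field_simps)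
qed

lemma arc_not_finitely_many_quadratics:
  fixes A :: "'i \<Rightarrow> real mat"
  assumes I: "finite I"
    and A: "\<And>i. i \<in> I \<Longrightarrow> A i \<in> carrier_mat 2 2" "\<And>i. i \<in> I \<Longrightarrow> transpose_mat (A i) = A i"
  shows "arc_set \<noteq> {x \<in> carrier_vec 2. \<forall>i\<in>I. x \<bullet> (A i *\<^sub>v x) \<le> 1}"
proof
  assume eq: "arc_set = {x \<in> carrier_vec 2. \<forall>i\<in>I. x \<bullet> (A i *\<^sub>v x) \<le> 1}"
  define a b c where "a i = A i $$ (0, 0)" and "b i = A i $$ (0, 1)" and "c i = A i $$ (1, 1)" for i
  have mem: "vec2 u v \<in> arc_set \<longleftrightarrow> (\<forall>i\<in>I. a i * u\<^sup>2 + 2 * b i * u * v + c i * v\<^sup>2 \<le> 1)" for u v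
    unfolding eq by (simp add: quad_form_vec2 A a_def b_def c_def)
  have c_le: "c i \<le> 1" if "i \<in> I" for i
    using that mem[of 0 1] vec2_in_arc_set_iff[of 0 1] by simp
  have tight: "\<exists>i\<in>I. a i + 2 * b i * s + c i * s\<^sup>2 = 2 + 2 * s\<^sup>2" if s: "s \<in> {-1..1}" for s
  proof (rule finite_family_tight_on_ray[OF I])
    show "0 < 2 + 2 * s\<^sup>2" by (simp add: add_pos_nonneg)
    show "(\<forall>i\<in>I. r\<^sup>2 * (a i + 2 * b i * s + c i * s\<^sup>2) \<le> 1) \<longleftrightarrow> r\<^sup>2 * (2 + 2 * s\<^sup>2) \<le> 1" for r
      using mem[of r "r * s"] arc_set_on_ray[OF s, of r]
      by (simp add: power2_eq_square algebra_simps)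
  qed
  \<comment> \<open>The leading coefficient \<open>2 - c i\<close> is positive, since the point \<open>(0,1)\<close> forces \<open>c i \<le> 1\<close>.\<close>
  define p where "p i = [:2 - a i, - 2 * b i, 2 - c i:]" for i
  have "finite {s. poly (p i) s = 0}" if "i \<in> I" for i
    using c_le[OF that] by (intro poly_roots_finite) (auto simp: p_def)
  then have "finite (\<Union>i\<in>I. {s. poly (p i) s = 0})" using I by simp
  moreover have "{-1..1} \<subseteq> (\<Union>i\<in>I. {s. poly (p i) s = 0})"
    using tight by (fastforce simp: p_def power2_eq_square algebra_simps)
  ultimately have "finite {-1..1::real}" by (rule rev_finite_subset)
  then show False using infinite_Icc[of "-1" "1::real"] by simp
qed

theorem proposition4p1:
  fixes d :: nat
  shows
    "(\<forall>n E. generalized_ellipsoid n d E \<longrightarrow>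
        (\<exists>(m::nat) (P :: nat \<Rightarrow> real mat).
           (\<forall>i\<in>{1..m}. psd_mat n (P i)) \<and>
           E = {x \<in> carrier_vec n. \<forall>i\<in>{1..m}. x \<bullet> (P i *\<^sub>v x) \<le> 1}))
     \<longleftrightarrow> d \<in> {0, 1}"
    (is "?finite \<longleftrightarrow> _")
proof
  assume fin: ?finite
  show "d \<in> {0, 1}"
  proof (rule ccontr)
    assume "d \<notin> {0, 1}"
    then have "generalized_ellipsoid 2 d arc_set"
      by (intro generalized_ellipsoid_arc_set) auto
    then obtain m :: nat and P where "\<forall>i\<in>{1..m}. psd_mat 2 (P i)"
      and "arc_set = {x \<in> carrier_vec 2. \<forall>i\<in>{1..m}. x \<bullet> (P i *\<^sub>v x) \<le> 1}"
      using fin by blast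
    then show False
      using arc_not_finitely_many_quadratics[of "{1..m}" P] by (auto simp: psd_mat_def)
  qed
next
  assume "d \<in> {0, 1}"
  then have d: "d \<le> 1" by auto
  show ?finite
  proof (intro allI impI)
    fix n E
    assume "generalized_ellipsoid n d E"
    then obtain A B where AB: "psd_mat n A" "psd_mat n B"
      "E = {x \<in> carrier_vec n. x \<bullet> (A *\<^sub>v x) \<le> 1 \<and> x \<bullet> (B *\<^sub>v x) \<le> 1}"
      using generalized_ellipsoid_degree_le_1[OF _ d] by blast
    define P where "P i = (if i = 1 then A else B)" for i :: nat
    have "{1..2} = {1, 2::nat}" by auto
    with AB have "(\<forall>i\<in>{1..2}. psd_mat n (P i)) \<and>
        E = {x \<in> carrier_vec n. \<forall>i\<in>{1..2}. x \<bullet> (P i *\<^sub>v x) \<le> 1}"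
      by (simp add: P_def)
    then show "\<exists>(m::nat) (P :: nat \<Rightarrow> real mat). (\<forall>i\<in>{1..m}. psd_mat n (P i)) \<and>
        E = {x \<in> carrier_vec n. \<forall>i\<in>{1..m}. x \<bullet> (P i *\<^sub>v x) \<le> 1}"
      by blast
  qed
qed

end
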